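(* Let $d\in\{2,3\}$, $1\le k\le 5$, $\delta t>0$, $\nu>0$, and let $\mathbf u_0\in \mathbf V\cap \mathbf H^2_p(\Omega)$ if $d=2$, $\mathbf u_0\in\mathbf V$ if $d=3$. Let $\{r^{n},\xi^{n},\bar{\mathbf u}_N^n,\mathbf u_N^n\}$ be the solution of the fully discrete scheme (FD$_k$) described in the context. (i) For every $n\ge k-1$, if $r^n\ge 0$, then $r^{n+1}\ge 0$, $\xi^{n+1}\ge 0$, and, without any restriction on $\delta t$, the scheme is energy stable in the sense that $$r^{n+1}-r^n=\begin{cases}-\delta t\,\nu\,\xi^{n+1}\|\Delta\bar{\mathbf u}_N^{n+1}\|^2\le 0,& d=2,\\ -\delta t\,\nu\,\xi^{n+1}\|\nabla\bar{\mathbf u}_N^{n+1}\|^2\le 0,& d=3.\end{cases}$$ (ii) Furthermore, if the starting value of the scalar auxiliary variable is nonnegative, there exists $M_k>0$, depending only on $k$ and on that starting value, such that for all $n\ge k-1$ $$\|\nabla\mathbf u_N^{n+1}\|^2\le M_k^2\quad (d=2),\qquad \|\mathbf u_N^{n+1}\|^2\le M_k^2\quad (d=3).$$ The same results (i) and (ii) hold for the solution $\{r^n,\xi^n,\bar{\mathbf u}^n,\mathbf u^n\}$ of the semi-discrete scheme (SD$_k$) described in the context, with $\bar{\mathbf u}_N^{n+1}$ and $\mathbf u_N^{n+1}$ replaced by $\bar{\mathbf u}^{n+1}$ and $\mathbf u^{n+1}$.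
   Context: **Setting.** $\Omega\subset\mathbb R^d$ is a rectangular box with side lengths $L_1,\dots,L_d$, and all functions are periodic on $\Omega$. $(\cdot,\cdot)$ and $\|\cdot\|$ are the $L^2(\Omega)$ inner product and norm. $H^s_p(\Omega)$ is the space of periodic functions in the Sobolev space $H^s$ with zero mean over $\Omega$, with norm $\|\cdot\|_s$; boldface denotes vector-valued versions. $\mathbf V=\{\mathbf v\in\mathbf H^1_p(\Omega):\nabla\cdot\mathbf v=0\}$. The schemes approximate the incompressible Navier-Stokes equations $\partial_t\mathbf u-\nu\Delta\mathbf u+(\mathbf u\cdot\nabla)\mathbf u+\nabla p=0$, $\nabla\cdot\mathbf u=0$, $\mathbf u|_{t=0}=\mathbf u_0$, with periodic boundary conditions. **Operator $\mathbf A$.** For mean-zero $\mathbf v$, $\Delta^{-1}\mathbf v$ is the periodic mean-zero solution $\mathbf w$ of $\Delta\mathbf w=\mathbf v$, and $\mathbf A\mathbf v:=\nabla\times\nabla\times\Delta^{-1}\mathbf v$ (where $\nabla\times\nabla\times\mathbf w=\nabla(\nabla\cdot\mathbf w)-\Delta\mathbf w$; in Fourier space the zero mode is set to zero). **Energy.** $E(\mathbf u)=\frac12\|\nabla\mathbf u\|^2$ if $d=2$ and $E(\mathbf u)=\frac12\|\mathbf u\|^2$ if $d=3$. The scalar auxiliary variable $r^n$ approximates $r(t^n)=E(\mathbf u(t^n))+1$, $t^n=n\,\delta t$. **BDF/extrapolation operators.** For a sequence $(\mathbf v^n)$: - $k=1$: $\alpha_1=1$, $A_1(\mathbf v^n)=\mathbf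 v^n$, $B_1(\mathbf v^n)=\mathbf v^n$. - $k=2$: $\alpha_2=\frac32$, $A_2(\mathbf v^n)=2\mathbf v^n-\frac12\mathbf v^{n-1}$, $B_2(\mathbf v^n)=2\mathbf v^n-\mathbf v^{n-1}$. - $k=3$: $\alpha_3=\frac{11}6$, $A_3(\mathbf v^n)=3\mathbf v^n-\frac32\mathbf v^{n-1}+\frac13\mathbf v^{n-2}$, $B_3(\mathbf v^n)=3\mathbf v^n-3\mathbf v^{n-1}+\mathbf v^{n-2}$. - $k=4$: $\alpha_4=\frac{25}{12}$, $A_4(\mathbf v^n)=4\mathbf v^n-3\mathbf v^{n-1}+\frac43\mathbf v^{n-2}-\frac14\mathbf v^{n-3}$, $B_4(\mathbf v^n)=4\mathbf v^n-6\mathbf v^{n-1}+4\mathbf v^{n-2}-\mathbf v^{n-3}$. - $k=5$: $\alpha_5=\frac{137}{60}$, $A_5(\mathbf v^n)=5\mathbf v^n-5\mathbf v^{n-1}+\frac{10}3\mathbf v^{n-2}-\frac54\mathbf v^{n-3}+\frac15\mathbf v^{n-4}$, $B_5(\mathbf v^n)=5\mathbf v^n-10\mathbf v^{n-1}+10\mathbf v^{n-2}-5\mathbf v^{n-3}+\mathbf v^{n-4}$. **Fourier space.** For a positive even integer $N$, $S_N$ is the span of the exponentials $\prod_{l=1}^d e^{2\pi i j_l x_l/L_l}$ with $-N/2\le j_l\le N/2-1$, excluding the constants (the same symbol is used for vector-valued functions). **Scheme (SD$_k$)** (semi-discrete). Given starting values $\bar{\mathbf u}^j,\mathbf u^j$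 ($0\le j\le k-1$) and $r^{k-1}$, for $n\ge k-1$ compute consecutively $\bar{\mathbf u}^{n+1},r^{n+1},\xi^{n+1},\mathbf u^{n+1}$ from $$\frac{\alpha_k\bar{\mathbf u}^{n+1}-A_k(\bar{\mathbf u}^n)}{\delta t}-\nu\Delta\bar{\mathbf u}^{n+1}-\mathbf A\big(B_k(\mathbf u^n)\cdot\nabla B_k(\mathbf u^n)\big)=0,$$ $$\frac{r^{n+1}-r^n}{\delta t}=\begin{cases}-\nu\frac{r^{n+1}}{E(\bar{\mathbf u}^{n+1})+1}\|\Delta\bar{\mathbf u}^{n+1}\|^2,&d=2,\\-\nu\frac{r^{n+1}}{E(\bar{\mathbf u}^{n+1})+1}\|\nabla\bar{\mathbf u}^{n+1}\|^2,&d=3,\end{cases}$$ $$\xi^{n+1}=\frac{r^{n+1}}{E(\bar{\mathbf u}^{n+1})+1},\qquad \mathbf u^{n+1}=\eta_k^{n+1}\bar{\mathbf u}^{n+1},\quad \eta_k^{n+1}=1-(1-\xi^{n+1})^k.$$ **Scheme (FD$_k$)** (fully discrete). Same as (SD$_k$) with all velocities $\bar{\mathbf u}_N^n,\mathbf u_N^n\in S_N$ in place of $\bar{\mathbf u}^n,\mathbf u^n$, and with the first equation replaced by its Galerkin form: for all $v_N\in S_N$, $$\Big(\frac{\alpha_k\bar{\mathbf u}_N^{n+1}-A_k(\bar{\mathbf u}_N^n)}{\delta t},v_N\Big)+\nu\big(\nabla\bar{\mathbf u}_N^{n+1},\nabla v_N\big)-\big(\mathbf A(B_k(\mathbf u_N^n)\cdot\nabla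 B_k(\mathbf u_N^n)),v_N\big)=0.$$ *)

theory Defs
  imports "HOL-Analysis.Analysis"
begin

text \<open>
  Functions on the periodic box with side lengths \<open>L $ i\<close> are functions on the whole space that are
  \<open>L $ i\<close>-periodic in the \<open>i\<close>-th coordinate; integrals are taken over one period cell.
  They are complex-valued, because the span of the modes \<open>- N/2 \<le> j\<^sub>l \<le> N/2 - 1\<close> is not closed under
  complex conjugation.  Real-valued functions are included.
\<close>

abbreviation cell :: "real^'d \<Rightarrow> (real^'d) measure" where
  "cell L \<equiv> lebesgue_on (cbox 0 L)"

definition periodic :: "real^'d \<Rightarrow> (real^'d \<Rightarrow> 'b) \<Rightarrow> bool" where
  "periodic L f \<longleftrightarrow> (\<forall>x i. f (x + axis i (L $ i)) = f x)"

definition mean :: "real^'d \<Rightarrow> (real^'d \<Rightarrow> 'b::euclidean_space) \<Rightarrow> 'b" where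
  "mean L f = (\<integral>x. f x \<partial>cell L) /\<^sub>R measure lebesgue (cbox 0 L)"

definition l2norm :: "real^'d \<Rightarrow> (real^'d \<Rightarrow> 'b::euclidean_space) \<Rightarrow> real" where
  "l2norm L f = sqrt (\<integral>x. (norm (f x))\<^sup>2 \<partial>cell L)"

definition l2inner :: "real^'d \<Rightarrow> (real^'d \<Rightarrow> complex^'d) \<Rightarrow> (real^'d \<Rightarrow> complex^'d) \<Rightarrow> complex" where
  "l2inner L f g = (\<integral>x. (\<Sum>i\<in>UNIV. f x $ i * cnj (g x $ i)) \<partial>cell L)"

definition in_Lp :: "real^'d \<Rightarrow> nat \<Rightarrow> (real^'d \<Rightarrow> complex) \<Rightarrow> bool" where
  "in_Lp L p f \<longleftrightarrow> f \<in> borel_measurable (cell L) \<and> integrable (cell L) (\<lambda>x. norm (f x) ^ p)"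


subsection \<open>Weak derivatives and periodic Sobolev spaces\<close>

definition cpartial :: "'d \<Rightarrow> (real^'d \<Rightarrow> complex) \<Rightarrow> real^'d \<Rightarrow> complex" where
  "cpartial i f x = frechet_derivative f (at x) (axis i 1)"

definition test_functions :: "real^'d \<Rightarrow> (real^'d \<Rightarrow> complex) set" where
  "test_functions L =
     {\<phi>. periodic L \<phi> \<and> (\<forall>is x. foldr cpartial is \<phi> differentiable (at x))}"

definition is_weak_partial ::
    "real^'d \<Rightarrow> 'd \<Rightarrow> (real^'d \<Rightarrow> complex) \<Rightarrow> (real^'d \<Rightarrow> complex) \<Rightarrow> bool" where
  "is_weak_partial L i f g \<longleftrightarrow>
     integrable (cell L) f \<and> integrable (cell L) g \<and> periodic L g \<and>
     (\<forall>\<phi>\<in>test_functions L.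
        (\<integral>x. f x * cpartial i \<phi> x \<partial>cell L) = - (\<integral>x. g x * \<phi> x \<partial>cell L))"

text \<open>Weak derivatives are unique up to null sets; a representative is chosen.\<close>

definition wpartial :: "real^'d \<Rightarrow> 'd \<Rightarrow> (real^'d \<Rightarrow> complex) \<Rightarrow> real^'d \<Rightarrow> complex" where
  "wpartial L i f = (SOME g. is_weak_partial L i f g)"

primrec sobolev :: "real^'d \<Rightarrow> nat \<Rightarrow> nat \<Rightarrow> (real^'d \<Rightarrow> complex) \<Rightarrow> bool" where
  "sobolev L p 0 f \<longleftrightarrow> periodic L f \<and> in_Lp L p f"
| "sobolev L p (Suc s) f \<longleftrightarrow> periodic L f \<and> in_Lp L p f \<and>
     (\<forall>i. \<exists>g. is_weak_partial L i f g \<and> sobolev L p s g)"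

definition Wp :: "real^'d \<Rightarrow> nat \<Rightarrow> nat \<Rightarrow> (real^'d \<Rightarrow> complex^'d) set" where
  "Wp L p s = {u. (\<forall>i. sobolev L p s (\<lambda>x. u x $ i)) \<and> mean L u = 0}"

abbreviation Hp :: "real^'d \<Rightarrow> nat \<Rightarrow> (real^'d \<Rightarrow> complex^'d) set" where
  "Hp L s \<equiv> Wp L 2 s"

text \<open>Entry \<open>(i, j)\<close> of the gradient is the \<open>j\<close>-th derivative of the \<open>i\<close>-th component.\<close>

definition wgrad :: "real^'d \<Rightarrow> (real^'d \<Rightarrow> complex^'d) \<Rightarrow> real^'d \<Rightarrow> complex^'d^'d" where
  "wgrad L u x = (\<chi> i j. wpartial L j (\<lambda>y. u y $ i) x)"

definition wdiv :: "real^'d \<Rightarrow> (real^'d \<Rightarrow> complex^'d) \<Rightarrow> real^'d \<Rightarrow> complex" where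
  "wdiv L u x = (\<Sum>j\<in>UNIV. wpartial L j (\<lambda>y. u y $ j) x)"

definition wlap :: "real^'d \<Rightarrow> (real^'d \<Rightarrow> complex^'d) \<Rightarrow> real^'d \<Rightarrow> complex^'d" where
  "wlap L u x = (\<chi> i. \<Sum>j\<in>UNIV. wpartial L j (wpartial L j (\<lambda>y. u y $ i)) x)"

definition wcurlcurl :: "real^'d \<Rightarrow> (real^'d \<Rightarrow> complex^'d) \<Rightarrow> real^'d \<Rightarrow> complex^'d" where
  "wcurlcurl L u x = (\<chi> i. wpartial L i (wdiv L u) x) - wlap L u x"

definition Vp :: "real^'d \<Rightarrow> (real^'d \<Rightarrow> complex^'d) set" where
  "Vp L = {v \<in> Hp L 1. AE x in cell L. wdiv L v x = 0}"


subsection \<open>The operators of the scheme\<close>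

text \<open>
  The mean of the argument is removed first, that is, its zero Fourier mode is set to zero; for
  mean-zero \<open>v\<close> this is the mean-zero solution of \<open>\<Delta>w = v\<close>.  The solution is sought
  with second weak derivatives in \<open>L\<^sup>1\<close>: for \<open>b\<close> in \<open>H\<^sup>1\<close> and \<open>d \<le> 3\<close> the
  convection term of \<open>b\<close> lies in some \<open>L\<^sup>q\<close> with \<open>q > 1\<close>, so \<open>w\<close> has second
  derivatives in \<open>L\<^sup>q\<close>, but is in general not in \<open>H\<^sup>2\<close>.
\<close>

definition inv_lap :: "real^'d \<Rightarrow> (real^'d \<Rightarrow> complex^'d) \<Rightarrow> real^'d \<Rightarrow> complex^'d" where
  "inv_lap L v = (SOME w. w \<in> Wp L 1 2 \<and> (AE x in cell L. wlap L w x = v x - mean L v))"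

definition opA :: "real^'d \<Rightarrow> (real^'d \<Rightarrow> complex^'d) \<Rightarrow> real^'d \<Rightarrow> complex^'d" where
  "opA L v = wcurlcurl L (inv_lap L v)"

definition convect :: "real^'d \<Rightarrow> (real^'d \<Rightarrow> complex^'d) \<Rightarrow> real^'d \<Rightarrow> complex^'d" where
  "convect L b x = (\<chi> i. \<Sum>j\<in>UNIV. b x $ j * wgrad L b x $ i $ j)"

definition energy :: "real^'d \<Rightarrow> (real^'d \<Rightarrow> complex^'d) \<Rightarrow> real" where
  "energy L u = (if CARD('d) = 2 then (l2norm L (wgrad L u))\<^sup>2 / 2 else (l2norm L u)\<^sup>2 / 2)"

definition dissipation :: "real^'d \<Rightarrow> (real^'d \<Rightarrow> complex^'d) \<Rightarrow> real" where
  "dissipation L u = (if CARD('d) = 2 then (l2norm L (wlap L u))\<^sup>2 else (l2norm L (wgrad L u))\<^sup>2)"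

definition bdf_alpha :: "nat \<Rightarrow> real" where
  "bdf_alpha k = [1, 3/2, 11/6, 25/12, 137/60] ! (k - 1)"

definition bdf_A :: "nat \<Rightarrow> (nat \<Rightarrow> 'a::real_vector) \<Rightarrow> nat \<Rightarrow> 'a" where
  "bdf_A k v n = (\<Sum>i<k.
     ([[1],
       [2, -1/2],
       [3, -3/2, 1/3],
       [4, -3, 4/3, -1/4],
       [5, -5, 10/3, -5/4, 1/5]] ! (k - 1) ! i) *\<^sub>R v (n - i))"

definition bdf_B :: "nat \<Rightarrow> (nat \<Rightarrow> 'a::real_vector) \<Rightarrow> nat \<Rightarrow> 'a" where
  "bdf_B k v n = (\<Sum>i<k.
     ([[1],
       [2, -1],
       [3, -3, 1],
       [4, -6, 4, -1],
       [5, -10, 10, -5, 1]] ! (k - 1) ! i) *\<^sub>R v (n - i))"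

definition bdf_quotient ::
    "nat \<Rightarrow> real \<Rightarrow> (nat \<Rightarrow> real^'d \<Rightarrow> complex^'d) \<Rightarrow> nat \<Rightarrow> real^'d \<Rightarrow> complex^'d" where
  "bdf_quotient k dt ubar n x =
     (bdf_alpha k *\<^sub>R ubar (n + 1) x - bdf_A k (\<lambda>m. ubar m x) n) /\<^sub>R dt"

definition nonlinear_term ::
    "real^'d \<Rightarrow> nat \<Rightarrow> (nat \<Rightarrow> real^'d \<Rightarrow> complex^'d) \<Rightarrow> nat \<Rightarrow> real^'d \<Rightarrow> complex^'d" where
  "nonlinear_term L k u n = opA L (convect L (\<lambda>x. bdf_B k (\<lambda>m. u m x) n))"


subsection \<open>The schemes\<close>

definition fourier_mode :: "real^'d \<Rightarrow> int^'d \<Rightarrow> real^'d \<Rightarrow> complex" where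
  "fourier_mode L j x =
     (\<Prod>l\<in>UNIV. exp (2 * of_real pi * \<i> * of_int (j $ l) * of_real (x $ l / L $ l)))"

definition mode_indices :: "nat \<Rightarrow> (int^'d) set" where
  "mode_indices N = {j. j \<noteq> 0 \<and> (\<forall>l. - int (N div 2) \<le> j $ l \<and> j $ l \<le> int (N div 2) - 1)}"

definition S_space :: "real^'d \<Rightarrow> nat \<Rightarrow> (real^'d \<Rightarrow> complex^'d) set" where
  "S_space L N = {v. \<exists>c. v = (\<lambda>x. \<Sum>j\<in>mode_indices N. fourier_mode L j x *s c j)}"

definition sav_step ::
    "real^'d \<Rightarrow> nat \<Rightarrow> real \<Rightarrow> real \<Rightarrow> (nat \<Rightarrow> real^'d \<Rightarrow> complex^'d) \<Rightarrow>
     (nat \<Rightarrow> real^'d \<Rightarrow> complex^'d) \<Rightarrow> (nat \<Rightarrow> real) \<Rightarrow> (nat \<Rightarrow> real) \<Rightarrow> nat \<Rightarrow> bool" where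
  "sav_step L k dt \<nu> ubar u r \<xi> n \<longleftrightarrow>
     (r (n + 1) - r n) / dt =
       - \<nu> * (r (n + 1) / (energy L (ubar (n + 1)) + 1)) * dissipation L (ubar (n + 1)) \<and>
     \<xi> (n + 1) = r (n + 1) / (energy L (ubar (n + 1)) + 1) \<and>
     u (n + 1) = (\<lambda>x. (1 - (1 - \<xi> (n + 1)) ^ k) *\<^sub>R ubar (n + 1) x)"

text \<open>
  The momentum equation holds almost everywhere, with weak derivatives.  In dimension two the new
  velocity must lie in \<open>H\<^sup>2\<close> for the dissipation to be finite.  In dimension three \<open>H\<^sup>1\<close> is
  enough for that, and the second derivatives are only asked to be integrable, as for \<open>inv_lap\<close>.
\<close>

definition SD_solution ::
    "real^'d \<Rightarrow> nat \<Rightarrow> real \<Rightarrow> real \<Rightarrow> (nat \<Rightarrow> real^'d \<Rightarrow> complex^'d) \<Rightarrow>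
     (nat \<Rightarrow> real^'d \<Rightarrow> complex^'d) \<Rightarrow> (nat \<Rightarrow> real) \<Rightarrow> (nat \<Rightarrow> real) \<Rightarrow> bool" where
  "SD_solution L k dt \<nu> ubar u r \<xi> \<longleftrightarrow>
     (\<forall>n. ubar n \<in> Hp L 1 \<and> u n \<in> Hp L 1) \<and>
     (\<forall>n\<ge>k - 1.
        ubar (n + 1) \<in> (if CARD('d) = 2 then Hp L 2 else Wp L 1 2) \<and>
        (AE x in cell L.
           bdf_quotient k dt ubar n x - \<nu> *\<^sub>R wlap L (ubar (n + 1)) x - nonlinear_term L k u n x = 0) \<and>
        sav_step L k dt \<nu> ubar u r \<xi> n)"

definition FD_solution ::
    "real^'d \<Rightarrow> nat \<Rightarrow> nat \<Rightarrow> real \<Rightarrow> real \<Rightarrow> (nat \<Rightarrow> real^'d \<Rightarrow> complex^'d) \<Rightarrow>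
     (nat \<Rightarrow> real^'d \<Rightarrow> complex^'d) \<Rightarrow> (nat \<Rightarrow> real) \<Rightarrow> (nat \<Rightarrow> real) \<Rightarrow> bool" where
  "FD_solution L N k dt \<nu> ubar u r \<xi> \<longleftrightarrow>
     (\<forall>n. ubar n \<in> S_space L N \<and> u n \<in> S_space L N) \<and>
     (\<forall>n\<ge>k - 1.
        (\<forall>v\<in>S_space L N.
           l2inner L (bdf_quotient k dt ubar n) v
           + \<nu> * (\<Sum>i\<in>UNIV. l2inner L (\<lambda>x. wgrad L (ubar (n + 1)) x $ i) (\<lambda>x. wgrad L v x $ i))
           - l2inner L (nonlinear_term L k u n) v = 0) \<and>
        sav_step L k dt \<nu> ubar u r \<xi> n)"

definition problem_data :: "real^'d \<Rightarrow> real \<Rightarrow> real \<Rightarrow> (real^'d \<Rightarrow> complex^'d) \<Rightarrow> bool" where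
  "problem_data L dt \<nu> u0 \<longleftrightarrow> (\<forall>i. L $ i > 0) \<and> dt > 0 \<and> \<nu> > 0 \<and>
     u0 \<in> (if CARD('d) = 2 then Vp L \<inter> Hp L 2 else Vp L)"

definition scheme_solution ::
    "real^'d \<Rightarrow> nat \<Rightarrow> real \<Rightarrow> real \<Rightarrow> (nat \<Rightarrow> real^'d \<Rightarrow> complex^'d) \<Rightarrow>
     (nat \<Rightarrow> real^'d \<Rightarrow> complex^'d) \<Rightarrow> (nat \<Rightarrow> real) \<Rightarrow> (nat \<Rightarrow> real) \<Rightarrow> bool" where
  "scheme_solution L k dt \<nu> ubar u r \<xi> \<longleftrightarrow>
     (\<exists>N>0. even N \<and> FD_solution L N k dt \<nu> ubar u r \<xi>) \<or> SD_solution L k dt \<nu> ubar u r \<xi>"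

end

theory Submission
  imports Defs "HOL-Real_Asymp.Real_Asymp"
begin

text \<open>
  Both parts come from the update of the scalar auxiliary variable and the final rescaling.  With \<open>E\<close> and \<open>D\<close> the
  energy and dissipation of the new intermediate velocity, the update is a linear equation for
  \<open>\<xi>\<^sup>n\<^sup>+\<^sup>1\<close> with solution \<open>r\<^sup>n / (E + 1 + \<delta>t \<nu> D)\<close>.  This gives the signs and the energy law
  for every step size (\<open>sav_step_energy_stable\<close>), and \<open>r\<close> stays between \<open>0\<close> and its starting
  value \<open>R\<close>.

  Hence \<open>0 \<le> \<xi>\<^sup>n\<^sup>+\<^sup>1 \<le> R / (E + 1)\<close>.  The final velocity is the intermediate one times
  \<open>1 - (1 - \<xi>\<^sup>n\<^sup>+\<^sup>1)\<^sup>k\<close>, which is \<open>\<xi>\<^sup>n\<^sup>+\<^sup>1\<close> times a polynomial bounded in terms of \<open>k\<close> and \<open>R\<close>, so its energy is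
  at most a constant times \<open>E / (E + 1)\<^sup>2\<close>, and this is bounded whatever \<open>E\<close> is
  (\<open>sav_factor_energy_bound\<close>).

  The analytic content is the identity \<open>\<parallel>\<nabla>(c v)\<parallel> = |c| \<parallel>\<nabla>v\<parallel>\<close>, needed in dimension two.  The gradient is built
  from arbitrarily chosen weak derivatives, so the identity rests on their existence and their uniqueness
  up to null sets.  Uniqueness (\<open>weak_partial_unique_AE\<close>) holds because indicators of boxes are bounded
  pointwise limits of explicit smooth periodic functions.  Existence is part of the definition of the
  Sobolev spaces for the semi-discrete scheme; for trigonometric polynomials it is integration by parts
  over a period cell (\<open>test_function_weak_partial\<close>).
\<close>

section \<open>Smooth functions given by closed formulas\<close>

text \<open>
  Smooth test functions are needed in closed form.  This class is large enough for the Fourier modes and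
  for the bumps below, and it is closed under partial derivatives, so membership gives derivatives of
  all orders at once.
\<close>
inductive_set elementary :: "(real^'d \<Rightarrow> complex) set" where
  const: "(\<lambda>x. c) \<in> elementary"
| coord: "(\<lambda>x. of_real (x $ i)) \<in> elementary"
| add: "f \<in> elementary \<Longrightarrow> g \<in> elementary \<Longrightarrow> (\<lambda>x. f x + g x) \<in> elementary"
| mult: "f \<in> elementary \<Longrightarrow> g \<in> elementary \<Longrightarrow> (\<lambda>x. f x * g x) \<in> elementary"
| exp: "f \<in> elementary \<Longrightarrow> (\<lambda>x. exp (f x)) \<in> elementary"

lemma cpartial_eq:
  assumes "(f has_derivative f') (at x)"
  shows "cpartial i f x = f' (axis i 1)"
  using frechet_derivative_at[OF assms] by (simp add: cpartial_def)

lemma has_derivative_cpartial: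
  assumes "f differentiable (at x)"
  shows "(f has_derivative frechet_derivative f (at x)) (at x)"
  using assms by (simp add: frechet_derivative_works)

lemma cpartial_mult:
  assumes "f differentiable (at x)" "g differentiable (at x)"
  shows "cpartial i (\<lambda>x. f x * g x) x = f x * cpartial i g x + cpartial i f x * g x"
  using cpartial_eq[OF has_derivative_mult[OF has_derivative_cpartial[OF assms(1)] has_derivative_cpartial[OF assms(2)]]]
  by (simp add: cpartial_def)

lemma cpartial_add:
  assumes "f differentiable (at x)" "g differentiable (at x)"
  shows "cpartial i (\<lambda>x. f x + g x) x = cpartial i f x + cpartial i g x"
  using cpartial_eq[OF has_derivative_add[OF has_derivative_cpartial[OF assms(1)] has_derivative_cpartial[OF assms(2)]]]
  by (simp add: cpartial_def)

lemma has_derivative_exp_comp: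
  fixes f :: "real^'d \<Rightarrow> complex"
  assumes "f differentiable (at x)"
  shows "((\<lambda>x. exp (f x)) has_derivative (\<lambda>h. frechet_derivative f (at x) h * exp (f x))) (at x)"
proof -
  have "(exp has_derivative (\<lambda>h. h * exp (f x))) (at (f x))"
    using DERIV_exp[of "f x"] by (simp add: has_field_derivative_def mult_commute_abs)
  from has_derivative_compose[OF has_derivative_cpartial[OF assms] this] show ?thesis .
qed

lemma elementary_smooth:
  fixes f :: "real^'d \<Rightarrow> complex"
  assumes "f \<in> elementary"
  shows "(\<forall>x. f differentiable (at x)) \<and> (\<forall>i. cpartial i f \<in> elementary)"
  using assms
proof induction
  case (const c)
  have "cpartial i (\<lambda>x::real^'d. c) = (\<lambda>x. 0)" for i
    by (rule ext, subst cpartial_eq[where f'="\<lambda>x. 0"]) auto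
  then show ?case by (simp add: elementary.const)
next
  case (coord j)
  have d: "((\<lambda>x::real^'d. complex_of_real (x $ j)) has_derivative (\<lambda>h. of_real (h $ j))) (at x)" for x
    by (auto intro!: derivative_eq_intros bounded_linear_imp_has_derivative bounded_linear_compose[OF bounded_linear_of_real bounded_linear_vec_nth])
  have "cpartial i (\<lambda>x::real^'d. complex_of_real (x $ j)) = (\<lambda>x. of_real (axis i 1 $ j))" for i
    by (rule ext, subst cpartial_eq[OF d]) auto
  then show ?case using d by (auto intro: elementary.const simp: differentiable_def)
next
  case (add f g)
  then have "cpartial i (\<lambda>x. f x + g x) = (\<lambda>x. cpartial i f x + cpartial i g x)" for i
    by (auto simp: cpartial_add)
  then show ?case using add by (auto intro: elementary.add)
next
  case (mult f g)
  then have "cpartial i (\<lambda>x. f x * g x) = (\<lambda>x. f x * cpartial i g x + cpartial i f x * g x)" for i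
    by (auto simp: cpartial_mult)
  then show ?case using mult by (auto intro!: elementary.add elementary.mult)
next
  case (exp f)
  then have d: "((\<lambda>x. exp (f x)) has_derivative (\<lambda>h. frechet_derivative f (at x) h * exp (f x))) (at x)" for x
    by (intro has_derivative_exp_comp) auto
  have "cpartial i (\<lambda>x. exp (f x)) = (\<lambda>x. cpartial i f x * exp (f x))" for i
    by (rule ext, subst cpartial_eq[OF d]) (simp add: cpartial_def)
  then show ?case using exp d by (auto intro: elementary.intros simp: differentiable_def)
qed

lemma elementary_test_function:
  assumes "f \<in> elementary" "periodic L f"
  shows "f \<in> test_functions L"
proof -
  have "foldr cpartial is f \<in> elementary" for "is"
    by (induction "is") (use assms elementary_smooth in auto)
  then show ?thesis using assms elementary_smooth by (auto simp: test_functions_def)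
qed

lemma elementary_sum:
  assumes "\<And>j. j \<in> J \<Longrightarrow> f j \<in> elementary"
  shows "(\<lambda>x. \<Sum>j\<in>J. f j x) \<in> elementary"
  using assms by (induction J rule: infinite_finite_induct) (auto intro: elementary.intros)

lemma elementary_prod:
  assumes "\<And>j. j \<in> J \<Longrightarrow> f j \<in> elementary"
  shows "(\<lambda>x. \<Prod>j\<in>J. f j x) \<in> elementary"
  using assms by (induction J rule: infinite_finite_induct) (auto intro: elementary.intros)

lemma elementary_diff:
  assumes "f \<in> elementary" "g \<in> elementary"
  shows "(\<lambda>x. f x - g x) \<in> elementary"
  using elementary.add[OF assms(1) elementary.mult[OF elementary.const[of "-1"] assms(2)]] by simp

lemma elementary_sin:
  assumes "f \<in> elementary"
  shows "(\<lambda>x. sin (f x)) \<in> elementary"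
proof -
  have "(\<lambda>x. (1 / (2 * \<i>)) * (exp (\<i> * f x) - exp ((- \<i>) * f x))) \<in> elementary"
    by (intro elementary.intros elementary_diff assms)
  then show ?thesis by (simp add: sin_exp_eq)
qed

lemma periodic_cpartial:
  assumes p: "periodic L f" and "\<And>x. f differentiable (at x)"
  shows "periodic L (cpartial i f)"
  unfolding periodic_def
proof (intro allI)
  fix x j
  let ?s = "axis j (L $ j)"
  have "((\<lambda>y. f (y + ?s)) has_derivative frechet_derivative f (at (x + ?s))) (at x)"
    by (rule has_derivative_compose[OF _ has_derivative_cpartial[OF assms(2)]])
       (auto intro!: derivative_eq_intros)
  then have "(f has_derivative frechet_derivative f (at (x + ?s))) (at x)"
    using p by (simp add: periodic_def)
  then show "cpartial i f (x + ?s) = cpartial i f x"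
    by (simp add: cpartial_eq) (simp add: cpartial_def)
qed

section \<open>Integration by parts over a period cell\<close>

text \<open>
  The boxes \<open>[0, L]\<close> and \<open>[0, L] + t e\<^sub>i\<close> both arise from their hull by cutting off a slab of thickness
  \<open>t\<close> in direction \<open>i\<close>, and the two slabs differ by one period.
\<close>
lemma integral_periodic_shift:
  fixes f :: "real^'d \<Rightarrow> complex"
  assumes p: "periodic L f" and c: "continuous_on UNIV f" and t: "0 \<le> t" "t \<le> L $ i"
  shows "integral (cbox 0 L) (\<lambda>x. f (x + axis i t)) = integral (cbox 0 L) f"
proof -
  define L' where "L' = L + axis i t"
  have int: "f integrable_on cbox a b" for a b
    by (rule integrable_continuous) (rule continuous_on_subset[OF c subset_UNIV])
  have slab: "cbox a b \<inter> {x. x \<bullet> axis i 1 \<le> c} = cbox a (\<chi> l. if l = i then min (b $ i) c else b $ l)"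
    "cbox a b \<inter> {x. x \<bullet> axis i 1 \<ge> c} = cbox (\<chi> l. if l = i then max (a $ i) c else a $ l) b"
    for a b :: "real^'d" and c
    unfolding inner_axis by (auto simp: mem_box_cart split: if_splits)
  have B: "axis i 1 \<in> (Basis :: (real^'d) set)" by simp
  have 1: "cbox 0 L' \<inter> {x. x \<bullet> axis i 1 \<le> L $ i} = cbox 0 L"
    "cbox 0 L' \<inter> {x. x \<bullet> axis i 1 \<ge> L $ i} = cbox (0 + axis i (L $ i)) (axis i t + (L - axis i (L$i)) + axis i (L $ i))"
    "cbox 0 L' \<inter> {x. x \<bullet> axis i 1 \<le> t} = cbox 0 (axis i t + (L - axis i (L$i)))"
    "cbox 0 L' \<inter> {x. x \<bullet> axis i 1 \<ge> t} = cbox (0 + axis i t) (L + axis i t)"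
    using t unfolding slab by (auto intro!: arg_cong2[of _ _ _ _ cbox] simp: vec_eq_iff L'_def axis_def)
  have "integral (cbox 0 L) f + integral (cbox (0 + axis i (L $ i)) (axis i t + (L - axis i (L$i)) + axis i (L $ i))) f
     = integral (cbox 0 (axis i t + (L - axis i (L$i)))) f + integral (cbox (0 + axis i t) (L + axis i t)) f"
    using integral_split[OF int B, of 0 L' "L $ i"] integral_split[OF int B, of 0 L' t]
    unfolding 1 by simp
  moreover have "f \<circ> (+) (axis i (L $ i)) = f"
    using p by (auto simp: periodic_def add.commute)
  ultimately show ?thesis
    unfolding integral_shift_cbox_plus[symmetric] by (simp add: o_def add.commute)
qed

lemma axis_scaleR: "axis i t = t *\<^sub>R axis i (1::real)"
  by (simp add: vec_eq_iff axis_def)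

text \<open>
  By shift invariance \<open>L\<^sub>i\<close> times the integral is the integral of \<open>\<partial>\<^sub>i h(x + t e\<^sub>i)\<close> over \<open>x\<close> in the cell, integrated
  over \<open>t\<close> in \<open>[0, L\<^sub>i]\<close>.  Exchanging the integrals, the inner one is \<open>h(x + L\<^sub>i e\<^sub>i) - h(x) = 0\<close>.  This avoids
  singling out the \<open>i\<close>-th coordinate by a product decomposition of the cell.
\<close>
lemma integral_cpartial_periodic:
  fixes h :: "real^'d \<Rightarrow> complex"
  assumes p: "periodic L h" and d: "\<And>x. h differentiable (at x)"
    and c: "continuous_on UNIV (cpartial i h)" and L: "L $ i > 0"
  shows "integral (cbox 0 L) (cpartial i h) = 0"
proof -
  let ?g = "cpartial i h"
  have c': "continuous_on S (\<lambda>(x, t). ?g (x + axis i t))" for S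
    unfolding case_prod_beta axis_scaleR[of i "snd _"]
    by (rule continuous_on_compose2[OF c]) (auto intro!: continuous_intros)
  have "integral {0..L $ i} (\<lambda>t. ?g (x + axis i t)) = 0" for x
  proof -
    have "((\<lambda>t. ?g (x + axis i t)) has_integral h (x + axis i (L $ i)) - h (x + axis i 0)) {0..L $ i}"
    proof (rule fundamental_theorem_of_calculus)
      fix t
      have "((\<lambda>t. x + t *\<^sub>R axis i 1) has_derivative (\<lambda>s. s *\<^sub>R axis i 1)) (at t within {0..L $ i})"
        by (auto intro!: derivative_eq_intros)
      from has_derivative_compose[OF this has_derivative_cpartial[OF d]]
      have "((\<lambda>t. h (x + t *\<^sub>R axis i 1)) has_derivative
          (\<lambda>s. frechet_derivative h (at (x + t *\<^sub>R axis i 1)) (s *\<^sub>R axis i 1))) (at t within {0..L $ i})" .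
      moreover have "frechet_derivative h (at (x + t *\<^sub>R axis i 1)) (s *\<^sub>R axis i 1) = s *\<^sub>R ?g (x + t *\<^sub>R axis i 1)" for s
        unfolding cpartial_def
        using linear_frechet_derivative[OF d] by (rule linear_scale)
      ultimately show "((\<lambda>t. h (x + axis i t)) has_vector_derivative ?g (x + axis i t)) (at t within {0..L $ i})"
        by (simp add: has_vector_derivative_def axis_scaleR[symmetric])
    qed (use L in simp)
    moreover have "axis i (0::real) = 0" by (simp add: vec_eq_iff axis_def)
    ultimately show ?thesis using p by (simp add: periodic_def integral_unique)
  qed
  then have "0 = integral (cbox 0 L) (\<lambda>x. integral (cbox 0 (L $ i)) (\<lambda>t. ?g (x + axis i t)))"
    by (simp add: box_real)
  also have "\<dots> = integral (cbox 0 (L $ i)) (\<lambda>t. integral (cbox 0 L) (\<lambda>x. ?g (x + axis i t)))"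
    by (rule integral_swap_continuous[OF c'])
  also have "\<dots> = integral (cbox 0 (L $ i)) (\<lambda>t. integral (cbox 0 L) ?g)"
    by (rule integral_cong) (use integral_periodic_shift[OF periodic_cpartial[OF p d] c] in \<open>simp add: box_real\<close>)
  also have "\<dots> = (L $ i) *\<^sub>R integral (cbox 0 L) ?g"
    using L by simp
  finally show ?thesis using L by simp
qed

lemma integrable_cell_continuous:
  fixes f :: "real^'d \<Rightarrow> complex"
  assumes "continuous_on UNIV f"
  shows "integrable (cell L) f"
  using absolutely_integrable_continuous[OF continuous_on_subset[OF assms subset_UNIV], of 0 L]
  by (simp add: set_integrable_def integrable_restrict_space)

lemma integral_cell_eq:
  fixes f :: "real^'d \<Rightarrow> complex"
  assumes "continuous_on UNIV f"
  shows "(\<integral>x. f x \<partial>cell L) = integral (cbox 0 L) f"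
  using has_integral_integral_lebesgue_on[OF integrable_cell_continuous[OF assms, of L]]
  by (simp add: integral_unique)

lemma test_functionD:
  assumes "\<phi> \<in> test_functions L"
  shows "periodic L \<phi>" "\<phi> differentiable (at x)" "continuous_on UNIV \<phi>" "continuous_on UNIV (cpartial i \<phi>)"
proof -
  have d: "foldr cpartial is \<phi> differentiable (at x)" for "is" x
    using assms by (auto simp: test_functions_def)
  show "periodic L \<phi>" using assms by (simp add: test_functions_def)
  show "\<phi> differentiable (at x)" using d[of "[]"] by simp
  show "continuous_on UNIV \<phi>"
    using d[of "[]"] by (auto intro!: continuous_at_imp_continuous_on differentiable_imp_continuous_within)
  show "continuous_on UNIV (cpartial i \<phi>)"
    using d[of "[i]"] by (auto intro!: continuous_at_imp_continuous_on differentiable_imp_continuous_within)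
qed

text \<open>
  Integration by parts: \<open>\<partial>\<^sub>i (f \<phi>)\<close> has integral zero over the cell because \<open>f \<phi>\<close> is periodic.
\<close>
lemma test_function_weak_partial:
  assumes f: "f \<in> test_functions L" and L: "L $ i > 0"
  shows "is_weak_partial L i f (cpartial i f)"
  unfolding is_weak_partial_def
proof (intro conjI ballI)
  note F = test_functionD[OF f]
  show "integrable (cell L) f" "integrable (cell L) (cpartial i f)"
    using F by (auto intro: integrable_cell_continuous)
  show "periodic L (cpartial i f)" using F by (intro periodic_cpartial)
  fix \<phi> assume "\<phi> \<in> test_functions L"
  note P = test_functionD[OF this]
  have eq: "cpartial i (\<lambda>x. f x * \<phi> x) = (\<lambda>x. f x * cpartial i \<phi> x + cpartial i f x * \<phi> x)"
    using F P by (auto simp: cpartial_mult)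
  have c: "continuous_on UNIV (\<lambda>x. f x * cpartial i \<phi> x)" "continuous_on UNIV (\<lambda>x. cpartial i f x * \<phi> x)"
    using F P by (auto intro!: continuous_intros)
  have "integral (cbox 0 L) (cpartial i (\<lambda>x. f x * \<phi> x)) = 0"
  proof (rule integral_cpartial_periodic)
    show "continuous_on UNIV (cpartial i (\<lambda>x. f x * \<phi> x))"
      unfolding eq using c by (intro continuous_on_add)
  qed (use F P L in \<open>auto simp: periodic_def\<close>)
  then have "(\<integral>x. f x * cpartial i \<phi> x + cpartial i f x * \<phi> x \<partial>cell L) = 0"
    unfolding eq by (subst integral_cell_eq) (auto intro!: continuous_on_add c)
  then show "(\<integral>x. f x * cpartial i \<phi> x \<partial>cell L) = - (\<integral>x. cpartial i f x * \<phi> x \<partial>cell L)"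
    by (subst (asm) Bochner_Integration.integral_add) (auto intro: integrable_cell_continuous c simp: eq_neg_iff_add_eq_0)
qed

section \<open>Uniqueness of weak derivatives\<close>

text \<open>
  With \<open>s\<^sub>l(x)\<close> the product of the two sines, which is \<open>L\<^sub>l\<close>-periodic since both factors change sign,
  the summand is \<open>exp (n - n\<^sup>2 s\<^sub>l(x))\<close>.  As \<open>n\<close> grows it tends to \<open>0\<close> where \<open>s\<^sub>l(x) > 0\<close> and to infinity where
  \<open>s\<^sub>l(x) \<le> 0\<close>; the linear term \<open>n\<close> decides the boundary case \<open>s\<^sub>l(x) = 0\<close>.
\<close>
definition box_bump :: "real^'d \<Rightarrow> real^'d \<Rightarrow> real^'d \<Rightarrow> nat \<Rightarrow> real^'d \<Rightarrow> real" where
  "box_bump L a b n x = exp (- (\<Sum>l\<in>UNIV. exp (real n - (real n)\<^sup>2 *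
     (sin (pi * (x $ l - a $ l) / L $ l) * sin (pi * (b $ l - x $ l) / L $ l)))))"

lemma box_bump_test_function:
  assumes L: "\<And>i. L $ i > 0"
  shows "(\<lambda>x. complex_of_real (box_bump L a b n x)) \<in> test_functions L"
proof (rule elementary_test_function)
  \<comment> \<open>The bump with complex arithmetic, in the shape to which the closure rules apply.\<close>
  have "(\<lambda>x. exp ((-1) * (\<Sum>l\<in>UNIV. exp (of_real (real n) - of_real ((real n)\<^sup>2) *
     (sin (of_real (pi / L $ l) * (of_real (x $ l) - of_real (a $ l))) *
      sin (of_real (pi / L $ l) * (of_real (b $ l) - of_real (x $ l)))))))) \<in> elementary"
    by (rule elementary.const elementary.coord elementary.exp elementary_sin elementary_diff
        elementary.mult elementary_sum)+
  also have "(\<lambda>x. exp ((-1) * (\<Sum>l\<in>UNIV. exp (of_real (real n) - of_real ((real n)\<^sup>2) *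
     (sin (of_real (pi / L $ l) * (of_real (x $ l) - of_real (a $ l))) *
      sin (of_real (pi / L $ l) * (of_real (b $ l) - of_real (x $ l)))))))) =
      (\<lambda>x. complex_of_real (box_bump L a b n x))"
    by (simp add: box_bump_def exp_of_real[symmetric] sin_of_real[symmetric])
  finally show "(\<lambda>x. complex_of_real (box_bump L a b n x)) \<in> elementary" .
  have "sin (pi * ((x + axis i (L $ i)) $ l - a $ l) / L $ l) * sin (pi * (b $ l - (x + axis i (L $ i)) $ l) / L $ l) =
    sin (pi * (x $ l - a $ l) / L $ l) * sin (pi * (b $ l - x $ l) / L $ l)" for x i l
  proof (cases "l = i")
    case True
    have "pi * ((x + axis i (L $ i)) $ l - a $ l) / L $ l = pi * (x $ l - a $ l) / L $ l + pi"
      "pi * (b $ l - (x + axis i (L $ i)) $ l) / L $ l = pi * (b $ l - x $ l) / L $ l - pi"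
      using L[of i] True by (simp_all add: axis_def field_simps)
    then show ?thesis by simp
  qed (simp add: axis_def)
  then show "periodic L (\<lambda>x. complex_of_real (box_bump L a b n x))"
    unfolding periodic_def box_bump_def by presburger
qed

lemma box_bump_bound: "0 \<le> box_bump L a b n x" "box_bump L a b n x \<le> 1"
  by (auto simp: box_bump_def intro: sum_nonneg)

text \<open>
  Both \<open>x - a\<close> and \<open>b - x\<close> lie in \<open>[-L, L]\<close>, where \<open>y \<mapsto> sin (\<pi> y / L)\<close> has the sign of \<open>y\<close> or vanishes, and
  \<open>a \<le> b\<close> rules out that both factors are negative.
\<close>
lemma sin_product_pos_iff:
  fixes L a b x :: real
  assumes "0 \<le> a" "a \<le> b" "b \<le> L" "0 \<le> x" "x \<le> L" "0 < L"
  shows "sin (pi * (x - a) / L) * sin (pi * (b - x) / L) > 0 \<longleftrightarrow> a < x \<and> x < b"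
proof -
  have *: "0 \<le> sin (pi * y / L)" "0 < y \<and> y < L \<Longrightarrow> 0 < sin (pi * y / L)" if "0 \<le> y" "y \<le> L" for y
    using that assms by (auto intro!: sin_ge_zero sin_gt_zero simp: field_simps)
  have neg: "sin (pi * - y / L) = - sin (pi * y / L)" for y by (simp flip: sin_minus)
  show ?thesis
  proof (cases "a < x \<and> x < b")
    case True
    then show ?thesis using *(2)[of "x - a"] *(2)[of "b - x"] assms by simp
  next
    case False
    then consider "x \<le> a" | "b \<le> x" by linarith
    then show ?thesis
    proof cases
      case 1
      then show ?thesis using *(1)[of "a - x"] *(1)[of "b - x"] neg[of "a - x"] assms False
        by (auto simp: not_less mult_nonpos_nonneg)
    next
      case 2
      then show ?thesis using *(1)[of "x - a"] *(1)[of "x - b"] neg[of "x - b"] assms False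
        by (auto simp: not_less mult_nonneg_nonpos)
    qed
  qed
qed

lemma box_bump_tendsto:
  assumes L: "\<And>i. L $ i > 0" and ab: "\<And>i. 0 \<le> a $ i \<and> a $ i \<le> b $ i \<and> b $ i \<le> L $ i"
    and x: "x \<in> cbox 0 L"
  shows "(\<lambda>n. box_bump L a b n x) \<longlonglongrightarrow> indicator (box a b) x"
proof -
  define s where "s l = sin (pi * (x $ l - a $ l) / L $ l) * sin (pi * (b $ l - x $ l) / L $ l)" for l
  have s: "s l > 0 \<longleftrightarrow> a $ l < x $ l \<and> x $ l < b $ l" for l
    unfolding s_def using sin_product_pos_iff[of "a $ l" "b $ l" "L $ l" "x $ l"] ab[of l] L[of l] x
    by (simp add: mem_box_cart)
  have bump: "box_bump L a b n x = exp (- (\<Sum>l\<in>UNIV. exp (real n - (real n)\<^sup>2 * s l)))" for n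
    by (simp add: box_bump_def s_def)
  show ?thesis
  proof (cases "x \<in> box a b")
    case True
    then have "s l > 0" for l using s by (simp add: mem_box_cart)
    moreover have "(\<lambda>n. exp (real n - (real n)\<^sup>2 * c)) \<longlonglongrightarrow> 0" if "c > 0" for c
      using that by real_asymp
    ultimately have "(\<lambda>n. exp (real n - (real n)\<^sup>2 * s l)) \<longlonglongrightarrow> 0" for l
      by blast
    then have "(\<lambda>n. exp (- (\<Sum>l\<in>UNIV. exp (real n - (real n)\<^sup>2 * s l)))) \<longlonglongrightarrow> exp (- (\<Sum>l\<in>(UNIV::'a set). 0))"
      by (intro tendsto_intros)
    then show ?thesis using True by (simp add: bump)
  next
    case False
    then obtain l where l: "s l \<le> 0" using s by (metis mem_box_cart(1) not_less)
    have bound: "norm (box_bump L a b n x) \<le> exp (- real n)" for n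
    proof -
      have "real n \<le> exp (real n)" using exp_ge_add_one_self[of "real n"] by linarith
      also have "\<dots> \<le> exp (real n - (real n)\<^sup>2 * s l)"
        using l by (simp add: mult_nonneg_nonpos)
      also have "\<dots> \<le> (\<Sum>l\<in>UNIV. exp (real n - (real n)\<^sup>2 * s l))"
        by (rule member_le_sum) auto
      finally show ?thesis by (simp add: bump)
    qed
    have "(\<lambda>n. exp (- real n)) \<longlonglongrightarrow> 0" by real_asymp
    then have "(\<lambda>n. box_bump L a b n x) \<longlonglongrightarrow> 0"
      by (rule Lim_null_comparison[OF always_eventually[OF allI[OF bound]]])
    then show ?thesis using False by simp
  qed
qed

lemma indicator_measurable_cell:
  assumes "A \<in> sets borel"
  shows "indicat_real A \<in> borel_measurable (cell L)"
  using assms by (intro measurable_restrict_space1 measurable_completion) simp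

text \<open>
  The bumps are dominated by \<open>1\<close> and converge to the indicator of the box, provided that the box is nonempty and lies in
  the cell.  Any other box is first clipped to the cell, which changes it on the cell only on a null set.
\<close>
lemma integral_box_eq_0:
  fixes w :: "real^'d \<Rightarrow> complex"
  assumes L: "\<And>i. L $ i > 0" and w: "integrable (cell L) w"
    and 0: "\<And>\<phi>. \<phi> \<in> test_functions L \<Longrightarrow> (\<integral>x. w x * \<phi> x \<partial>cell L) = 0"
  shows "(\<integral>x. indicator (box a b) x *\<^sub>R w x \<partial>cell L) = 0"
proof -
  define a' b' where "a' = (\<chi> i. max 0 (a $ i))" and "b' = (\<chi> i. min (L $ i) (b $ i))"
  have [measurable]: "w \<in> borel_measurable (cell L)" using w by simp
  have ind[measurable]: "indicat_real (box c d) \<in> borel_measurable (cell L)" for c d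
    by (rule indicator_measurable_cell) simp
  have "AE x in cell L. x \<in> box 0 L"
  proof -
    have "cbox 0 L - box 0 L \<in> null_sets lebesgue"
      using negligible_frontier_interval[of 0 L] by (simp add: negligible_iff_null_sets)
    then have "AE x in lebesgue. x \<notin> cbox 0 L - box 0 L" by (rule AE_not_in)
    then show ?thesis by (simp add: AE_restrict_space_iff)
  qed
  then have AE1: "AE x in cell L. indicat_real (box a b) x = indicator (box a' b') x"
  proof (rule eventually_mono)
    fix x assume "x \<in> box 0 L"
    then have "x \<in> box a b \<longleftrightarrow> x \<in> box a' b'"
      by (auto simp: mem_box_cart a'_def b'_def)
    then show "indicat_real (box a b) x = indicator (box a' b') x" by (simp add: indicator_def)
  qed
  have "(\<integral>x. indicator (box a b) x *\<^sub>R w x \<partial>cell L) = (\<integral>x. indicator (box a' b') x *\<^sub>R w x \<partial>cell L)"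
    by (rule integral_cong_AE) (use AE1 in \<open>auto elim: eventually_mono\<close>)
  also have "\<dots> = 0"
  proof (cases "\<forall>i. a' $ i \<le> b' $ i")
    case False
    then have "box a' b' = {}" unfolding interval_eq_empty_cart(1) by (auto simp: not_le intro: less_imp_le)
    then show ?thesis by simp
  next
    case True
    then have ab: "\<And>i. 0 \<le> a' $ i \<and> a' $ i \<le> b' $ i \<and> b' $ i \<le> L $ i"
      by (auto simp: a'_def b'_def)
    have "(\<lambda>n. \<integral>x. box_bump L a' b' n x *\<^sub>R w x \<partial>cell L) \<longlonglongrightarrow> (\<integral>x. indicator (box a' b') x *\<^sub>R w x \<partial>cell L)"
    proof (rule integral_dominated_convergence[where w="\<lambda>x. norm (w x)"])
      show "(\<lambda>x. box_bump L a' b' n x *\<^sub>R w x) \<in> borel_measurable (cell L)" for n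
      proof -
        have "continuous_on UNIV (box_bump L a' b' n)"
          unfolding box_bump_def using L by (auto intro!: continuous_intros simp: less_imp_neq[symmetric])
        then have "box_bump L a' b' n \<in> borel_measurable lebesgue"
          by (intro measurable_completion) (simp add: borel_measurable_continuous_onI)
        then have [measurable]: "box_bump L a' b' n \<in> borel_measurable (cell L)" by (rule measurable_restrict_space1)
        show ?thesis by measurable
      qed
      show "AE x in cell L. (\<lambda>n. box_bump L a' b' n x *\<^sub>R w x) \<longlonglongrightarrow> indicator (box a' b') x *\<^sub>R w x"
        by (rule AE_I2) (auto intro!: tendsto_intros box_bump_tendsto L ab)
      show "AE x in cell L. norm (box_bump L a' b' n x *\<^sub>R w x) \<le> norm (w x)" for n
        by (rule AE_I2) (auto simp: box_bump_bound intro!: mult_left_le_one_le)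
    qed (use w in auto)
    moreover have "(\<integral>x. box_bump L a' b' n x *\<^sub>R w x \<partial>cell L) = 0" for n
      using 0[OF box_bump_test_function[OF L], of a' b' n] by (simp add: scaleR_conv_of_real mult.commute)
    ultimately show ?thesis by (simp add: LIMSEQ_const_iff)
  qed
  finally show ?thesis .
qed

text \<open>
  Open boxes form an intersection-stable generator of the Borel sets, so the integral vanishes over every
  Borel set, and over every Lebesgue set because it is Borel up to a null set.
\<close>
lemma AE_cell_0_if_integral_boxes_0:
  fixes w :: "real^'d \<Rightarrow> complex"
  assumes w: "integrable (cell L) w"
    and 0: "\<And>a b. (\<integral>x. indicator (box a b) x *\<^sub>R w x \<partial>cell L) = 0"
  shows "AE x in cell L. w x = 0"
proof -
  have [measurable]: "w \<in> borel_measurable (cell L)" using w by simp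
  note indicator_measurable_cell[measurable]
  have int: "integrable (cell L) (\<lambda>x. indicator A x *\<^sub>R w x)" if "A \<in> sets borel" for A
  proof (rule Bochner_Integration.integrable_bound[OF w])
    show "(\<lambda>x. indicator A x *\<^sub>R w x) \<in> borel_measurable (cell L)" using that by measurable
    show "AE x in cell L. norm (indicator A x *\<^sub>R w x) \<le> norm (w x)"
      by (rule AE_I2) (auto simp: indicator_def)
  qed
  have total: "(\<integral>x. w x \<partial>cell L) = 0"
  proof -
    obtain a b where ab: "cbox 0 L \<subseteq> box a (b::real^'d)"
      using bounded_subset_box_symmetric[OF bounded_cbox] by metis
    have "(\<integral>x. w x \<partial>cell L) = (\<integral>x. indicator (box a b) x *\<^sub>R w x \<partial>cell L)"
      by (rule Bochner_Integration.integral_cong) (use ab in auto)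
    then show ?thesis using 0 by simp
  qed
  have borel: "(\<integral>x. indicator A x *\<^sub>R w x \<partial>cell L) = 0" if A: "A \<in> sets borel" for A
  proof -
    have sets_eq: "sigma_sets UNIV (range (\<lambda>(a, b). box a b :: (real^'d) set)) = sets borel"
      unfolding borel_eq_box by simp
    have "Int_stable (range (\<lambda>(a, b). box a b :: (real^'d) set))"
      by (auto simp: Int_stable_def box_Int_box)
    moreover have "range (\<lambda>(a, b). box a b :: (real^'d) set) \<subseteq> Pow UNIV" by auto
    moreover have "A \<in> sigma_sets UNIV (range (\<lambda>(a, b). box a b))" using A sets_eq by simp
    ultimately show ?thesis
    proof (induction rule: sigma_sets_induct_disjoint)
      case (basic A)
      then show ?case using 0 by auto
    next
      case empty
      then show ?case by simp
    next
      case (compl A)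
      then have "integrable (cell L) (\<lambda>x. indicator A x *\<^sub>R w x)" using sets_eq int by simp
      then have "(\<integral>x. w x - indicator A x *\<^sub>R w x \<partial>cell L) = 0"
        using w compl total by simp
      moreover have "indicator (UNIV - A) x *\<^sub>R w x = w x - indicator A x *\<^sub>R w x" for x
        by (auto simp: indicator_def)
      ultimately show ?case by simp
    next
      case (union F)
      then have F: "F i \<in> sets borel" for i using sets_eq by auto
      have "(\<lambda>i. \<integral>x. indicator (F i) x *\<^sub>R w x \<partial>cell L) sums (\<integral>x. indicator (\<Union>i. F i) x *\<^sub>R w x \<partial>cell L)"
      proof -
        have "(\<lambda>n. \<integral>x. indicator (\<Union>i<n. F i) x *\<^sub>R w x \<partial>cell L) \<longlonglongrightarrow> (\<integral>x. indicator (\<Union>i. F i) x *\<^sub>R w x \<partial>cell L)"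
        proof (rule integral_dominated_convergence[where w="\<lambda>x. norm (w x)"])
          show "(\<lambda>x. indicator (\<Union>i. F i) x *\<^sub>R w x) \<in> borel_measurable (cell L)"
            "(\<lambda>x. indicator (\<Union>i<n. F i) x *\<^sub>R w x) \<in> borel_measurable (cell L)" for n
            using F by (auto intro!: borel_measurable_integrable int)
          show "AE x in cell L. norm (indicator (\<Union>i<n. F i) x *\<^sub>R w x) \<le> norm (w x)" for n
            by (rule AE_I2) (auto simp: indicator_def)
          show "AE x in cell L. (\<lambda>n. indicator (\<Union>i<n. F i) x *\<^sub>R w x) \<longlonglongrightarrow> indicator (\<Union>i. F i) x *\<^sub>R w x"
            by (rule AE_I2) (intro tendsto_intros LIMSEQ_indicator_UN)
        qed (use w in simp)
        moreover have "(\<integral>x. indicator (\<Union>i<n. F i) x *\<^sub>R w x \<partial>cell L) = (\<Sum>i<n. \<integral>x. indicator (F i) x *\<^sub>R w x \<partial>cell L)" for n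
        proof -
          have "indicat_real (\<Union>i<n. F i) x = (\<Sum>i<n. indicator (F i) x)" for x
            using union(1) by (intro indicator_UN_disjoint) (auto simp: disjoint_family_on_def)
          then show ?thesis
            using int F by (simp only: scaleR_sum_left) (intro Bochner_Integration.integral_sum int F)
        qed
        ultimately show ?thesis by (simp add: sums_def)
      qed
      then show ?case using union by (simp add: sums_unique[symmetric] sums_unique2[OF _ sums_zero])
    qed
  qed
  interpret finite_measure "cell L" by (rule finite_measure_lebesgue_on) simp
  show ?thesis
  proof (rule density_zero[OF w])
    fix A assume A: "A \<in> sets (cell L)"
    then have "A \<in> sets (completion lborel)" by (simp add: sets_restrict_space_iff)
    then obtain S N N' where S: "A = S \<union> N" "N \<subseteq> N'" "N' \<in> null_sets lborel" "S \<in> sets lborel"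
      by (auto elim: sets_completionE)
    have "AE x in lebesgue. x \<notin> N'"
      using S(3) by (intro AE_completion AE_not_in)
    then have "AE x in cell L. x \<notin> N'" by (simp add: AE_restrict_space_iff eventually_mono)
    then have "AE x in cell L. indicat_real A x *\<^sub>R w x = indicator S x *\<^sub>R w x"
      by (rule eventually_mono) (use S in \<open>auto simp: indicator_def\<close>)
    then have "set_lebesgue_integral (cell L) A w = (\<integral>x. indicator S x *\<^sub>R w x \<partial>cell L)"
      unfolding set_lebesgue_integral_def
      using A S(4) by (intro integral_cong_AE) auto
    then show "set_lebesgue_integral (cell L) A w = 0" using borel S(4) by simp
  qed
qed

text \<open>
  The difference of two weak derivatives integrates to zero against every test function.  This makes
  the choice of a representative in \<open>wpartial\<close> harmless.
\<close>
lemma weak_partial_unique_AE: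
  assumes L: "\<And>i. L $ i > 0" and g: "is_weak_partial L i f g" and h: "is_weak_partial L i f h"
  shows "AE x in cell L. g x = h x"
proof -
  have int: "integrable (cell L) g" "integrable (cell L) h"
    using g h by (auto simp: is_weak_partial_def)
  have "AE x in cell L. g x - h x = 0"
  proof (intro AE_cell_0_if_integral_boxes_0 integral_box_eq_0 L)
    show "integrable (cell L) (\<lambda>x. g x - h x)" "integrable (cell L) (\<lambda>x. g x - h x)" using int by auto
    fix \<phi> assume \<phi>: "\<phi> \<in> test_functions L"
    have c: "continuous_on UNIV \<phi>" using test_functionD[OF \<phi>] by simp
    have "integrable (cell L) (\<lambda>x. k x * \<phi> x)" if k: "integrable (cell L) k" for k
    proof -
      obtain B where B: "\<And>x. x \<in> cbox 0 L \<Longrightarrow> norm (\<phi> x) \<le> B"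
        using compact_imp_bounded[OF compact_continuous_image[OF continuous_on_subset[OF c subset_UNIV] compact_cbox[of 0 L]]]
        unfolding bounded_iff by blast
      have [measurable]: "\<phi> \<in> borel_measurable (cell L)"
        using integrable_cell_continuous[OF c] by (rule borel_measurable_integrable)
      show ?thesis
      proof (rule Bochner_Integration.integrable_bound)
        show "integrable (cell L) (\<lambda>x. B *\<^sub>R k x)" using k by simp
        show "AE x in cell L. norm (k x * \<phi> x) \<le> norm (B *\<^sub>R k x)"
          by (rule AE_I2) (use B in \<open>force simp: norm_mult mult.commute intro!: mult_right_mono order_trans[OF B]\<close>)
      qed (use k in measurable)
    qed
    then show "(\<integral>x. (g x - h x) * \<phi> x \<partial>cell L) = 0"
      using g h \<phi> int by (simp add: left_diff_distrib is_weak_partial_def)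
  qed
  then show ?thesis by simp
qed

section \<open>Scaling of weak gradients\<close>

lemma is_weak_partial_scaleR:
  assumes "is_weak_partial L i f g"
  shows "is_weak_partial L i (\<lambda>x. c *\<^sub>R f x) (\<lambda>x. c *\<^sub>R g x)"
  using assms by (auto simp: is_weak_partial_def periodic_def)

lemma is_weak_partial_wpartial:
  "is_weak_partial L i f g \<Longrightarrow> is_weak_partial L i f (wpartial L i f)"
  unfolding wpartial_def by (rule someI[of "is_weak_partial L i f"])

lemma wpartial_scaleR_AE:
  assumes L: "\<And>i. L $ i > 0" and f: "is_weak_partial L i f g"
  shows "AE x in cell L. wpartial L i (\<lambda>x. c *\<^sub>R f x) x = c *\<^sub>R wpartial L i f x"
proof -
  have "is_weak_partial L i (\<lambda>x. c *\<^sub>R f x) (\<lambda>x. c *\<^sub>R wpartial L i f x)"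
    using f by (intro is_weak_partial_scaleR is_weak_partial_wpartial)
  then show ?thesis
    using weak_partial_unique_AE[OF L is_weak_partial_wpartial] by blast
qed

text \<open>
  Where no weak derivative exists, \<open>wpartial\<close> is an arbitrary function and need not scale with its
  argument; so every statement on scaling of \<open>wgrad\<close> has to carry this hypothesis.
\<close>
definition has_weak_gradient :: "real^'d \<Rightarrow> (real^'d \<Rightarrow> complex^'d) \<Rightarrow> bool" where
  "has_weak_gradient L v \<longleftrightarrow> (\<forall>i j. \<exists>g. is_weak_partial L j (\<lambda>x. v x $ i) g)"

lemma l2norm_cong_AE_scaleR:
  fixes f g :: "real^'d \<Rightarrow> 'b::euclidean_space"
  assumes [measurable]: "f \<in> borel_measurable (cell L)" "g \<in> borel_measurable (cell L)"
    and "AE x in cell L. f x = c *\<^sub>R g x"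
  shows "(l2norm L f)\<^sup>2 = c\<^sup>2 * (l2norm L g)\<^sup>2"
proof -
  have "(\<integral>x. (norm (f x))\<^sup>2 \<partial>cell L) = (\<integral>x. c\<^sup>2 * (norm (g x))\<^sup>2 \<partial>cell L)"
    by (rule integral_cong_AE) (use assms(3) in \<open>auto elim!: eventually_mono simp: power_mult_distrib\<close>)
  then show ?thesis by (simp add: l2norm_def)
qed

lemma borel_measurable_wgrad:
  fixes L :: "real^'d"
  assumes "has_weak_gradient L v"
  shows "wgrad L v \<in> borel_measurable (cell L)"
proof -
  have *: "wpartial L j (\<lambda>y. v y $ i) \<in> borel_measurable (cell L)" for i j
  proof -
    obtain g where "is_weak_partial L j (\<lambda>y. v y $ i) g"
      using assms unfolding has_weak_gradient_def by blast
    then have "is_weak_partial L j (\<lambda>y. v y $ i) (wpartial L j (\<lambda>y. v y $ i))"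
      by (rule is_weak_partial_wpartial)
    then show ?thesis by (simp add: is_weak_partial_def borel_measurable_integrable)
  qed
  show ?thesis
    unfolding borel_measurable_euclidean_space[where f="wgrad L v"]
  proof
    fix e :: "complex^'d^'d" assume "e \<in> Basis"
    then obtain i j c where e: "e = axis i (axis j c)" by (auto simp: Basis_vec_def)
    have "(\<lambda>x. wpartial L j (\<lambda>y. v y $ i) x \<bullet> c) \<in> borel_measurable (cell L)"
      by (intro borel_measurable_inner * borel_measurable_const)
    then show "(\<lambda>x. wgrad L v x \<bullet> e) \<in> borel_measurable (cell L)"
      by (simp add: e inner_axis wgrad_def)
  qed
qed

text \<open>
  The representatives chosen for the derivatives of \<open>c v\<close> and of \<open>v\<close> are unrelated choices.  They are
  proportional only almost everywhere, by uniqueness of weak derivatives; this suffices for the norm.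
\<close>
lemma l2norm_wgrad_scaleR:
  assumes L: "\<And>i. L $ i > 0" and v: "has_weak_gradient L v"
  shows "(l2norm L (wgrad L (\<lambda>x. c *\<^sub>R v x)))\<^sup>2 = c\<^sup>2 * (l2norm L (wgrad L v))\<^sup>2"
proof (rule l2norm_cong_AE_scaleR)
  have "has_weak_gradient L (\<lambda>x. c *\<^sub>R v x)"
    using v is_weak_partial_scaleR unfolding has_weak_gradient_def vector_scaleR_component by blast
  then show "wgrad L (\<lambda>x. c *\<^sub>R v x) \<in> borel_measurable (cell L)"
    by (rule borel_measurable_wgrad)
  have "AE x in cell L. wpartial L j (\<lambda>y. (c *\<^sub>R v y) $ i) x = c *\<^sub>R wpartial L j (\<lambda>y. v y $ i) x" for i j
    using v wpartial_scaleR_AE[OF L] unfolding has_weak_gradient_def vector_scaleR_component by blast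
  then have "AE x in cell L. \<forall>i j. wpartial L j (\<lambda>y. (c *\<^sub>R v y) $ i) x = c *\<^sub>R wpartial L j (\<lambda>y. v y $ i) x"
    by (simp add: AE_all_countable)
  then show "AE x in cell L. wgrad L (\<lambda>x. c *\<^sub>R v x) x = c *\<^sub>R wgrad L v x"
    by (rule eventually_mono) (simp add: wgrad_def vec_eq_iff)
qed (rule borel_measurable_wgrad[OF v])

lemma l2norm_scaleR: "(l2norm L (\<lambda>x. c *\<^sub>R v x))\<^sup>2 = c\<^sup>2 * (l2norm L v)\<^sup>2"
  by (simp add: l2norm_def power_mult_distrib)

section \<open>Weak gradients of the discrete velocities\<close>

lemma Hp_has_weak_gradient:
  assumes "v \<in> Hp L 1"
  shows "has_weak_gradient L v"
  using assms by (fastforce simp: Wp_def has_weak_gradient_def)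

lemma fourier_mode_elementary: "fourier_mode L j \<in> elementary"
proof -
  have "(\<lambda>x. \<Prod>l\<in>UNIV. exp ((2 * of_real pi * \<i> * of_int (j $ l) * of_real (1 / L $ l)) * of_real (x $ l))) \<in> elementary"
    by (rule elementary.const elementary.coord elementary.exp elementary.mult elementary_prod)+
  then show ?thesis by (simp add: fourier_mode_def[abs_def])
qed

lemma periodic_fourier_mode:
  assumes L: "\<And>i. L $ i > 0"
  shows "periodic L (fourier_mode L j)"
  unfolding periodic_def fourier_mode_def
proof (intro allI prod.cong refl)
  fix x i l
  have "exp (2 * of_real pi * \<i> * of_int (j $ l)) = 1"
    using exp_integer_2pi[of "of_int (j $ l)"] by (simp add: mult_ac)
  moreover have "(x + axis i (L $ i)) $ l / L $ l = x $ l / L $ l + (if l = i then 1 else 0)"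
    using L[of i] by (auto simp: axis_def field_simps)
  ultimately show "exp (2 * complex_of_real pi * \<i> * of_int (j $ l) * complex_of_real ((x + axis i (L $ i)) $ l / L $ l)) =
      exp (2 * complex_of_real pi * \<i> * of_int (j $ l) * complex_of_real (x $ l / L $ l))"
    by (auto simp: distrib_left exp_add)
qed

lemma S_space_has_weak_gradient:
  assumes L: "\<And>i. L $ i > 0" and v: "v \<in> S_space L N"
  shows "has_weak_gradient L v"
  unfolding has_weak_gradient_def
proof (intro allI exI)
  fix i j
  obtain c where c: "v = (\<lambda>x. \<Sum>j\<in>mode_indices N. fourier_mode L j x *s c j)"
    using v by (auto simp: S_space_def)
  have "(\<lambda>x. v x $ i) = (\<lambda>x. \<Sum>j\<in>mode_indices N. fourier_mode L j x * c j $ i)"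
    by (simp add: c)
  moreover have "(\<lambda>x. \<Sum>j\<in>mode_indices N. fourier_mode L j x * c j $ i) \<in> test_functions L"
  proof (rule elementary_test_function)
    show "(\<lambda>x. \<Sum>j\<in>mode_indices N. fourier_mode L j x * c j $ i) \<in> elementary"
      by (rule elementary_sum elementary.mult fourier_mode_elementary elementary.const)+
    show "periodic L (\<lambda>x. \<Sum>j\<in>mode_indices N. fourier_mode L j x * c j $ i)"
      using periodic_fourier_mode[OF L] by (simp add: periodic_def)
  qed
  ultimately have "(\<lambda>x. v x $ i) \<in> test_functions L" by simp
  then show "is_weak_partial L j (\<lambda>x. v x $ i) (cpartial j (\<lambda>x. v x $ i))"
    by (rule test_function_weak_partial) (rule L)
qed

lemma scheme_solution_sav_step:
  assumes "scheme_solution L k dt \<nu> ubar u r \<xi>" "n \<ge> k - 1"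
  shows "sav_step L k dt \<nu> ubar u r \<xi> n"
  using assms by (auto simp: scheme_solution_def FD_solution_def SD_solution_def)

lemma scheme_solution_has_weak_gradient:
  assumes "\<And>i. L $ i > 0" "scheme_solution L k dt \<nu> ubar u r \<xi>"
  shows "has_weak_gradient L (ubar n)"
  using assms S_space_has_weak_gradient[OF assms(1)] Hp_has_weak_gradient[of _ L]
  unfolding scheme_solution_def FD_solution_def SD_solution_def by blast

section \<open>Unconditional energy stability\<close>

lemma energy_nonneg: "0 \<le> energy L v"
  by (simp add: energy_def)

lemma dissipation_nonneg: "0 \<le> dissipation L v"
  by (simp add: dissipation_def)

text \<open>
  The update of \<open>r\<close> is linear: \<open>\<xi>\<^sup>n\<^sup>+\<^sup>1 (E + 1 + \<delta>t \<nu> D) = r\<^sup>n\<close> with \<open>E, D \<ge> 0\<close> the energy and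
  dissipation of the new velocity.  So the sign of \<open>r\<^sup>n\<close> is inherited, whatever the size of the step.
\<close>
lemma sav_step_energy_stable:
  assumes pos: "dt > 0" "\<nu> > 0" and step: "sav_step L k dt \<nu> ubar u r \<xi> n" and r: "r n \<ge> 0"
  shows "0 \<le> r (n + 1)" "0 \<le> \<xi> (n + 1)"
    "r (n + 1) - r n = - dt * \<nu> * \<xi> (n + 1) * dissipation L (ubar (n + 1))"
    "- dt * \<nu> * \<xi> (n + 1) * dissipation L (ubar (n + 1)) \<le> 0"
    "\<xi> (n + 1) = r (n + 1) / (energy L (ubar (n + 1)) + 1)"
proof -
  define E D where "E = energy L (ubar (n + 1)) + 1" and "D = dissipation L (ubar (n + 1))"
  have E: "E > 0" and D: "D \<ge> 0"
    using energy_nonneg[of L "ubar (n + 1)"] dissipation_nonneg by (auto simp: E_def D_def)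
  have xi: "\<xi> (n + 1) = r (n + 1) / E" and "(r (n + 1) - r n) / dt = - \<nu> * \<xi> (n + 1) * D"
    using step by (auto simp: sav_step_def E_def D_def)
  then have diff: "r (n + 1) - r n = - dt * \<nu> * \<xi> (n + 1) * D"
    using pos by (simp add: field_simps)
  have "\<xi> (n + 1) * (E + dt * \<nu> * D) = r n"
    using diff xi E by (simp add: field_simps)
  moreover have "E + dt * \<nu> * D > 0" using E D pos by (intro add_pos_nonneg) auto
  ultimately have "\<xi> (n + 1) = r n / (E + dt * \<nu> * D)" by (simp add: field_simps)
  then show *: "0 \<le> \<xi> (n + 1)" using r \<open>E + dt * \<nu> * D > 0\<close> by simp
  then show "0 \<le> r (n + 1)" using xi E by (simp add: zero_le_divide_iff)
  show "r (n + 1) - r n = - dt * \<nu> * \<xi> (n + 1) * dissipation L (ubar (n + 1))"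
    using diff by (simp add: D_def)
  show "- dt * \<nu> * \<xi> (n + 1) * dissipation L (ubar (n + 1)) \<le> 0"
    using * D pos by (simp add: D_def)
  show "\<xi> (n + 1) = r (n + 1) / (energy L (ubar (n + 1)) + 1)" using xi by (simp add: E_def)
qed

lemma scheme_r_bounds:
  assumes pos: "dt > 0" "\<nu> > 0" and sol: "scheme_solution L k dt \<nu> ubar u r \<xi>"
    and r: "r (k - 1) \<ge> 0" and n: "n \<ge> k - 1"
  shows "0 \<le> r n \<and> r n \<le> r (k - 1)"
  using n
proof (induction n rule: nat_induct_at_least)
  case base
  then show ?case using r by simp
next
  case (Suc n)
  then show ?case
    using sav_step_energy_stable(1,3,4)[OF pos scheme_solution_sav_step[OF sol]] by fastforce
qed

section \<open>Uniform bounds for the velocity\<close>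

text \<open>
  The summand \<open>1\<close> keeps the bound positive when \<open>R = 0\<close>.
\<close>
definition velocity_bound :: "nat \<Rightarrow> real \<Rightarrow> real" where
  "velocity_bound k R = 1 + R * (real k * (1 + R) ^ k)"

text \<open>
  The factor \<open>1 - (1 - \<xi>)\<^sup>k\<close> vanishes at \<open>\<xi> = 0\<close>; dividing by \<open>\<xi>\<close> leaves the geometric sum of the powers
  \<open>(1 - \<xi>)\<^sup>i\<close>, each bounded by \<open>(1 + R)\<^sup>k\<close>.
\<close>
lemma sav_factor_bound:
  fixes \<xi> R :: real
  assumes "0 \<le> \<xi>" "\<xi> \<le> R"
  shows "\<bar>1 - (1 - \<xi>) ^ k\<bar> \<le> \<xi> * (real k * (1 + R) ^ k)"
proof -
  have "\<bar>(1 - \<xi>) ^ i\<bar> \<le> (1 + R) ^ k" if "i < k" for i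
  proof -
    have "\<bar>(1 - \<xi>) ^ i\<bar> \<le> (1 + R) ^ i" unfolding power_abs using assms by (intro power_mono) auto
    also have "\<dots> \<le> (1 + R) ^ k" using that assms by (intro power_increasing) auto
    finally show ?thesis .
  qed
  then have "\<bar>\<Sum>i<k. (1 - \<xi>) ^ i\<bar> \<le> real k * (1 + R) ^ k"
    using sum_bounded_above[of "{..<k}" "\<lambda>i. \<bar>(1 - \<xi>) ^ i\<bar>" "(1 + R) ^ k"]
    by (intro order_trans[OF sum_abs]) auto
  moreover have "1 - (1 - \<xi>) ^ k = \<xi> * (\<Sum>i<k. (1 - \<xi>) ^ i)"
    using one_diff_power_eq[of "1 - \<xi>" k] by simp
  ultimately show ?thesis using assms by (simp add: abs_mult mult_left_mono)
qed

text \<open>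
  The factor is at most a constant times \<open>\<xi> \<le> R / (E + 1)\<close>.  This decay in \<open>E\<close> outweighs the growth of the
  energy, since \<open>2 E \<le> (E + 1)\<^sup>2\<close>.
\<close>
lemma sav_factor_energy_bound:
  fixes E R r :: real
  assumes "0 \<le> E" "0 \<le> r" "r \<le> R"
  shows "(1 - (1 - r / (E + 1)) ^ k)\<^sup>2 * (2 * E) \<le> (velocity_bound k R)\<^sup>2"
proof -
  define K where "K = real k * (1 + R) ^ k"
  have K: "K \<ge> 0" using assms by (simp add: K_def)
  have xi: "0 \<le> r / (E + 1)" "r / (E + 1) \<le> R / (E + 1)" "R / (E + 1) \<le> R"
    using assms divide_left_mono[of 1 "E + 1" R] by (simp_all add: divide_right_mono)
  have "\<bar>1 - (1 - r / (E + 1)) ^ k\<bar> \<le> r / (E + 1) * K"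
    unfolding K_def using xi by (intro sav_factor_bound) auto
  also have "\<dots> \<le> R / (E + 1) * K" using xi K by (intro mult_right_mono)
  finally have "(1 - (1 - r / (E + 1)) ^ k)\<^sup>2 \<le> (R / (E + 1) * K)\<^sup>2"
    by (rule abs_le_square_iff[THEN iffD1, OF order_trans[OF _ abs_ge_self]])
  then have "(1 - (1 - r / (E + 1)) ^ k)\<^sup>2 * (2 * E) \<le> (R / (E + 1) * K)\<^sup>2 * (2 * E)"
    using assms by (intro mult_right_mono) auto
  also have "\<dots> = (R * K)\<^sup>2 * (2 * E / (E + 1)\<^sup>2)"
    by (simp add: power_mult_distrib power_divide)
  also have "\<dots> \<le> (R * K)\<^sup>2 * 1"
    using assms by (intro mult_left_mono) (auto simp: divide_le_eq power2_sum)
  also have "\<dots> \<le> (velocity_bound k R)\<^sup>2"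
    using assms K unfolding velocity_bound_def K_def[symmetric] mult_1_right by (intro power_mono) auto
  finally show ?thesis .
qed

lemma velocity_energy:
  assumes L: "\<And>i. L $ i > 0" and v: "has_weak_gradient L v"
  shows "energy L (\<lambda>x. c *\<^sub>R v x) = c\<^sup>2 * energy L v"
  using l2norm_wgrad_scaleR[OF L v] by (simp add: energy_def l2norm_scaleR)

lemma scheme_velocity_bound:
  assumes data: "problem_data L dt \<nu> u0" and sol: "scheme_solution L k dt \<nu> ubar u r \<xi>"
    and r: "r (k - 1) \<ge> 0" and n: "n \<ge> k - 1"
  shows "2 * energy L (u (n + 1)) \<le> (velocity_bound k (r (k - 1)))\<^sup>2"
proof -
  have L: "\<And>i. L $ i > 0" and pos: "dt > 0" "\<nu> > 0" using data by (auto simp: problem_data_def)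
  note step = scheme_solution_sav_step[OF sol n]
  have rn: "0 \<le> r n" using scheme_r_bounds[OF pos sol r n] by simp
  have rn1: "0 \<le> r (n + 1)" "r (n + 1) \<le> r (k - 1)"
    using scheme_r_bounds[OF pos sol r, of "n + 1"] n by auto
  have xi: "\<xi> (n + 1) = r (n + 1) / (energy L (ubar (n + 1)) + 1)"
    by (rule sav_step_energy_stable(5)[OF pos step rn])
  have "u (n + 1) = (\<lambda>x. (1 - (1 - \<xi> (n + 1)) ^ k) *\<^sub>R ubar (n + 1) x)"
    using step by (simp add: sav_step_def)
  then have "2 * energy L (u (n + 1)) = (1 - (1 - \<xi> (n + 1)) ^ k)\<^sup>2 * (2 * energy L (ubar (n + 1)))"
    using velocity_energy[OF L scheme_solution_has_weak_gradient[OF L sol]] by simp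
  also have "\<dots> \<le> (velocity_bound k (r (k - 1)))\<^sup>2"
    unfolding xi by (rule sav_factor_energy_bound[OF energy_nonneg rn1])
  finally show ?thesis .
qed

lemma scheme_energy_stable:
  assumes data: "problem_data L dt \<nu> u0" and sol: "scheme_solution L k dt \<nu> ubar u r \<xi>"
    and n: "n \<ge> k - 1" and r: "r n \<ge> 0"
  shows "r (n + 1) \<ge> 0 \<and> \<xi> (n + 1) \<ge> 0 \<and>
    r (n + 1) - r n = - dt * \<nu> * \<xi> (n + 1) * dissipation L (ubar (n + 1)) \<and>
    - dt * \<nu> * \<xi> (n + 1) * dissipation L (ubar (n + 1)) \<le> 0"
proof -
  have "dt > 0" "\<nu> > 0" using data by (auto simp: problem_data_def)
  note stable = sav_step_energy_stable[OF this scheme_solution_sav_step[OF sol n] r]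
  show ?thesis by (intro conjI stable(1-4))
qed

theorem theorem1:
  fixes k :: nat
  assumes "1 \<le> k" and "k \<le> 5"
  shows
    "(\<forall>(L :: real^2) dt \<nu> u0 ubar u r \<xi>.
       problem_data L dt \<nu> u0 \<and> scheme_solution L k dt \<nu> ubar u r \<xi> \<longrightarrow>
       (\<forall>n\<ge>k - 1. r n \<ge> 0 \<longrightarrow>
          r (n + 1) \<ge> 0 \<and> \<xi> (n + 1) \<ge> 0 \<and>
          r (n + 1) - r n = - dt * \<nu> * \<xi> (n + 1) * (l2norm L (wlap L (ubar (n + 1))))\<^sup>2 \<and>
          - dt * \<nu> * \<xi> (n + 1) * (l2norm L (wlap L (ubar (n + 1))))\<^sup>2 \<le> 0)) \<and>
     (\<forall>(L :: real^3) dt \<nu> u0 ubar u r \<xi>.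
       problem_data L dt \<nu> u0 \<and> scheme_solution L k dt \<nu> ubar u r \<xi> \<longrightarrow>
       (\<forall>n\<ge>k - 1. r n \<ge> 0 \<longrightarrow>
          r (n + 1) \<ge> 0 \<and> \<xi> (n + 1) \<ge> 0 \<and>
          r (n + 1) - r n = - dt * \<nu> * \<xi> (n + 1) * (l2norm L (wgrad L (ubar (n + 1))))\<^sup>2 \<and>
          - dt * \<nu> * \<xi> (n + 1) * (l2norm L (wgrad L (ubar (n + 1))))\<^sup>2 \<le> 0)) \<and>
     (\<forall>r0\<ge>0. \<exists>M>0.
       (\<forall>(L :: real^2) dt \<nu> u0 ubar u r \<xi>.
          problem_data L dt \<nu> u0 \<and> scheme_solution L k dt \<nu> ubar u r \<xi> \<and> r (k - 1) = r0 \<longrightarrow>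
          (\<forall>n\<ge>k - 1. (l2norm L (wgrad L (u (n + 1))))\<^sup>2 \<le> M\<^sup>2)) \<and>
       (\<forall>(L :: real^3) dt \<nu> u0 ubar u r \<xi>.
          problem_data L dt \<nu> u0 \<and> scheme_solution L k dt \<nu> ubar u r \<xi> \<and> r (k - 1) = r0 \<longrightarrow>
          (\<forall>n\<ge>k - 1. (l2norm L (u (n + 1)))\<^sup>2 \<le> M\<^sup>2)))"
    (is "?stable2 \<and> ?stable3 \<and> (\<forall>r0\<ge>0. \<exists>M>0. ?bound2 r0 M \<and> ?bound3 r0 M)")
proof (intro conjI)
  have diss2: "dissipation L v = (l2norm L (wlap L v))\<^sup>2" for L :: "real^2" and v
    by (simp add: dissipation_def)
  have diss3: "dissipation L v = (l2norm L (wgrad L v))\<^sup>2" for L :: "real^3" and v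
    by (simp add: dissipation_def)
  show ?stable2
    unfolding diss2[symmetric]
    by (intro allI impI, elim conjE) (rule scheme_energy_stable)
  show ?stable3
    unfolding diss3[symmetric]
    by (intro allI impI, elim conjE) (rule scheme_energy_stable)
  have en2: "(l2norm L (wgrad L v))\<^sup>2 = 2 * energy L v" for L :: "real^2" and v
    by (simp add: energy_def)
  have en3: "(l2norm L v)\<^sup>2 = 2 * energy L v" for L :: "real^3" and v
    by (simp add: energy_def)
  show "\<forall>r0\<ge>0. \<exists>M>0. ?bound2 r0 M \<and> ?bound3 r0 M"
  proof (intro allI impI)
    fix r0 :: real assume r0: "r0 \<ge> 0"
    have "velocity_bound k r0 > 0"
      unfolding velocity_bound_def using r0 by (intro add_pos_nonneg) auto
    moreover have "?bound2 r0 (velocity_bound k r0)"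
      unfolding en2 using r0 by (intro allI impI, elim conjE, hypsubst) (rule scheme_velocity_bound)
    moreover have "?bound3 r0 (velocity_bound k r0)"
      unfolding en3 using r0 by (intro allI impI, elim conjE, hypsubst) (rule scheme_velocity_bound)
    ultimately show "\<exists>M>0. ?bound2 r0 M \<and> ?bound3 r0 M" by blast
  qed
qed

end
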